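(* Let $r\ge 2$ and let $\mathbf{a}=(a_1,\dots,a_r)$ be an $r$-tuple of positive integers which are pairwise coprime. For each integer $n\ge 2$ let $\mathbf{X}^{(n)}=(X^{(n)}_1,\dots,X^{(n)}_r)$, where the $X^{(n)}_j$ are independent random variables uniformly distributed in $\{1,\dots,n\}$. Then: (a) $$\lim_{n\to\infty}\mathbf{P}\big(\mathbf{X}^{(n)}\in\mathcal{PC}_{\mathbf{a}}\big)=T_r\,\frac{\Psi_{r-2}(|\mathbf{a}|)}{\Psi_{r-1}(|\mathbf{a}|)}.$$ (b) $$\lim_{n\to\infty}\mathbf{P}\big(\mathbf{X}^{(n)}\in\mathcal{C}_{\mathbf{a}}\big)=\frac{1}{\zeta(r)}\,\frac{\varphi(|\mathbf{a}|)}{\varphi_r(|\mathbf{a}|)}\,|\mathbf{a}|^{r-1}.$$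
   Context: $|\mathbf{a}|=a_1a_2\cdots a_r$. For $\mathbf{a}=(a_1,\dots,a_r)$, $\mathcal{PC}_{\mathbf{a}}$ is the set of $r$-tuples $\mathbf{x}=(x_1,\dots,x_r)$ of positive integers such that $\gcd(x_i,x_j)=1$ for all $i\neq j$ (pairwise coprime) and $\gcd(a_i,x_i)=1$ for all $i=1,\dots,r$. $\mathcal{C}_{\mathbf{a}}$ is the set of $r$-tuples $\mathbf{x}$ of positive integers such that $\gcd(x_1,\dots,x_r)=1$ (mutually coprime) and $\gcd(a_i,x_i)=1$ for all $i=1,\dots,r$. $T_r=\prod_p\big((1-\frac1p)^r+\frac rp(1-\frac1p)^{r-1}\big)$, the product being over all primes $p$. $\zeta$ is the Riemann zeta function. For each integer $s$, $\Psi_s(1)=1$ and $\Psi_s(a)=a\prod_{p\mid a}(1+\frac sp)$ for integers $a>1$ (product over primes $p$ dividing $a$). The Jordan totient function is $\varphi_r(1)=1$, $\varphi_r(a)=a^r\prod_{p\mid a}(1-\frac1{p^r})$ for $a>1$; $\varphi=\varphi_1$ is Euler's function. *)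

theory Defs
  imports "HOL-Probability.Probability" "HOL-Number_Theory.Number_Theory"
begin

(* An r-tuple (x_1, ..., x_r) of natural numbers is a function on the index set {1..r};
   in sets of tuples it is extensional, i.e. undefined outside {1..r}. *)

definition PC :: "nat \<Rightarrow> (nat \<Rightarrow> nat) \<Rightarrow> (nat \<Rightarrow> nat) set" where
  "PC r a = {x \<in> {1..r} \<rightarrow>\<^sub>E {0<..}.
     (\<forall>i\<in>{1..r}. \<forall>j\<in>{1..r}. i \<noteq> j \<longrightarrow> gcd (x i) (x j) = 1) \<and>
     (\<forall>i\<in>{1..r}. gcd (a i) (x i) = 1)}"

definition MC :: "nat \<Rightarrow> (nat \<Rightarrow> nat) \<Rightarrow> (nat \<Rightarrow> nat) set" where
  "MC r a = {x \<in> {1..r} \<rightarrow>\<^sub>E {0<..}.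
     Gcd (x ` {1..r}) = 1 \<and> (\<forall>i\<in>{1..r}. gcd (a i) (x i) = 1)}"

definition tuple_prod :: "nat \<Rightarrow> (nat \<Rightarrow> nat) \<Rightarrow> nat" where
  "tuple_prod r a = (\<Prod>i=1..r. a i)"

(* The product over all primes, taken in increasing order; indices that are not prime
   contribute the factor 1. *)
definition T :: "nat \<Rightarrow> real" where
  "T r = prodinf (\<lambda>p. if prime p
     then (1 - 1 / real p) ^ r + real r / real p * (1 - 1 / real p) ^ (r - 1) else 1)"

(* The Dirichlet series, which defines the Riemann zeta function for real s > 1 only. *)
definition riemann_zeta :: "real \<Rightarrow> real" where
  "riemann_zeta s = (\<Sum>n. 1 / real (Suc n) powr s)"

(* For a = 1 the products over prime factors below are empty, so both functions are 1 there. *)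

definition Psi :: "int \<Rightarrow> nat \<Rightarrow> real" where
  "Psi s a = real a * (\<Prod>p\<in>prime_factors a. 1 + real_of_int s / real p)"

definition jordan_totient :: "nat \<Rightarrow> nat \<Rightarrow> real" where
  "jordan_totient r a = real a ^ r * (\<Prod>p\<in>prime_factors a. 1 - 1 / real p ^ r)"

lemma jordan_totient_1: "jordan_totient 1 a = real (totient a)"
  by (simp add: jordan_totient_def totient_formula2)

end

theory Submission
  imports Defs
begin

text \<open>
  Membership in either set of tuples is a condition, for each prime \<open>p\<close>, on the set of indices
  \<open>i\<close> with \<open>p dvd x i\<close>. For finitely many primes, the density of the tuples satisfying these conditions
  in the box \<open>{1..n}\<^sup>r\<close> tends to the product of the local densities, because the coordinates
  are independent and because divisibility by different primes is asymptotically independent. A prime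
  \<open>p\<close> not dividing \<open>\<bar>a\<bar>\<close> can only violate its condition by dividing two coordinates, which has
  probability at most \<open>r\<^sup>2 / p\<^sup>2\<close>; as \<open>\<Sum>1 / p\<^sup>2\<close> converges, the
  limits in \<open>n\<close> and in the bound on the primes may be interchanged.
\<close>

section \<open>Densities in boxes\<close>

text \<open>The probability of \<open>Q\<close> under the uniform distribution on the box, written
  as a count, so that the arithmetic below runs without any probability space.\<close>

definition box_dens :: "'i set \<Rightarrow> nat \<Rightarrow> (('i \<Rightarrow> nat) \<Rightarrow> bool) \<Rightarrow> real" where
  "box_dens I n Q = real (card {x \<in> I \<rightarrow>\<^sub>E {1..n}. Q x}) / real n ^ card I"

text \<open>By independence every point of the box is attained with the same probability, and the
  tuple lies in the box almost surely. No measurability of \<open>Q\<close> has to be assumed,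
  because there are only countably many tuples of naturals.\<close>

lemma (in prob_space) prob_uniform_tuple:
  fixes X :: "'i \<Rightarrow> 'a \<Rightarrow> nat"
  assumes I: "finite I" "I \<noteq> {}" and n: "n > 0"
    and indep: "indep_vars (\<lambda>_. count_space UNIV) X I"
    and uniform: "\<And>i. i \<in> I \<Longrightarrow>
          distr M (count_space UNIV) (X i) = measure_pmf (pmf_of_set {1..n})"
  shows "\<P>(\<omega> in M. Q (\<lambda>i\<in>I. X i \<omega>)) = box_dens I n Q"
proof -
  have meas: "X i \<in> measurable M (count_space UNIV)" if "i \<in> I" for i
    using indep that by (auto simp: indep_vars_def2)
  have point: "prob (X i -` A \<inter> space M) = real (card ({1..n} \<inter> A)) / real n" if "i \<in> I" for i A
  proof -
    have "prob (X i -` A \<inter> space M) = measure (distr M (count_space UNIV) (X i)) A"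
      using meas[OF that] by (simp add: measure_distr)
    also have "\<dots> = real (card ({1..n} \<inter> A)) / real n"
      using n by (simp add: uniform[OF that] measure_pmf_of_set)
    finally show ?thesis .
  qed
  define E where "E x = (\<Inter>i\<in>I. X i -` {x i} \<inter> space M)" for x
  have E_iff: "\<omega> \<in> E x \<longleftrightarrow> \<omega> \<in> space M \<and> (\<forall>i\<in>I. X i \<omega> = x i)" for x \<omega>
    using I by (auto simp: E_def)
  have E_sets: "E x \<in> events" for x
    unfolding E_def using I meas by (intro sets.finite_INT) (auto intro: measurable_sets)
  have E_prob: "prob (E x) = 1 / real n ^ card I" if x: "x \<in> I \<rightarrow>\<^sub>E {1..n}" for x
  proof -
    have "prob (E x) = (\<Prod>i\<in>I. prob (X i -` {x i} \<inter> space M))"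
      unfolding E_def using I by (intro indep_varsD_finite[OF indep]) auto
    also have "\<dots> = (\<Prod>i\<in>I. 1 / real n)"
    proof (intro prod.cong refl)
      fix i assume i: "i \<in> I"
      then have "{1..n} \<inter> {x i} = {x i}" using x by auto
      then show "prob (X i -` {x i} \<inter> space M) = 1 / real n"
        by (simp only: point[OF i]) simp
    qed
    finally show ?thesis by (simp add: power_divide)
  qed
  \<comment> \<open>The union runs over all extensional tuples and not only over the box, since some
    \<open>X i\<close> may leave \<open>{1..n}\<close> on a null set. Being countable, it shows that
    the event is measurable.\<close>
  have ev: "{\<omega> \<in> space M. Q (\<lambda>i\<in>I. X i \<omega>)} = (\<Union>x\<in>{x \<in> I \<rightarrow>\<^sub>E UNIV. Q x}. E x)"
  proof (rule equalityI; rule subsetI)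
    fix \<omega> assume "\<omega> \<in> {\<omega> \<in> space M. Q (\<lambda>i\<in>I. X i \<omega>)}"
    then show "\<omega> \<in> (\<Union>x\<in>{x \<in> I \<rightarrow>\<^sub>E UNIV. Q x}. E x)"
      by (auto simp: E_iff intro!: exI[of _ "\<lambda>i\<in>I. X i \<omega>"])
  next
    fix \<omega> assume "\<omega> \<in> (\<Union>x\<in>{x \<in> I \<rightarrow>\<^sub>E UNIV. Q x}. E x)"
    then obtain x where x: "x \<in> I \<rightarrow>\<^sub>E UNIV" "Q x" "\<omega> \<in> E x" by auto
    then have "(\<lambda>i\<in>I. X i \<omega>) = x"
      by (auto simp: E_iff fun_eq_iff restrict_def PiE_def extensional_def)
    with x show "\<omega> \<in> {\<omega> \<in> space M. Q (\<lambda>i\<in>I. X i \<omega>)}" by (auto simp: E_iff)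
  qed
  have countable: "countable (I \<rightarrow>\<^sub>E (UNIV :: nat set))"
    using I by (intro countable_PiE) auto
  have ev_sets: "{\<omega> \<in> space M. Q (\<lambda>i\<in>I. X i \<omega>)} \<in> events"
    unfolding ev using E_sets
    by (intro sets.countable_UN') (auto intro: countable_subset[OF _ countable])
  let ?S = "{x \<in> I \<rightarrow>\<^sub>E {1..n}. Q x}"
  have fin: "finite ?S" using I by (simp add: finite_PiE)
  \<comment> \<open>The distribution of \<open>X i\<close> confines its values to
    \<open>{1..n}\<close> only up to a null set, so the reduction to the finite set
    \<open>?S\<close> is an almost-everywhere statement.\<close>
  have "AE \<omega> in M. X i \<omega> \<in> {1..n}" if i: "i \<in> I" for i
  proof -
    have "prob (X i -` {1..n} \<inter> space M) = 1"
      using point[OF i, of "{1..n}"] n by simp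
    moreover have "X i -` {1..n} \<inter> space M \<in> events"
      using meas[OF i] by (rule measurable_sets) simp
    ultimately have "AE \<omega> in M. \<omega> \<in> X i -` {1..n} \<inter> space M"
      by (simp add: prob_eq_1)
    then show ?thesis by eventually_elim auto
  qed
  then have "AE \<omega> in M. \<forall>i\<in>I. X i \<omega> \<in> {1..n}"
    using I by (simp add: AE_finite_all)
  then have "AE \<omega> in M. \<omega> \<in> {\<omega> \<in> space M. Q (\<lambda>i\<in>I. X i \<omega>)} \<longleftrightarrow> \<omega> \<in> (\<Union>x\<in>?S. E x)"
  proof (rule AE_mp, intro AE_I2 impI)
    fix \<omega> assume \<omega>: "\<omega> \<in> space M" "\<forall>i\<in>I. X i \<omega> \<in> {1..n}"
    define y where "y = (\<lambda>i\<in>I. X i \<omega>)"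
    have y: "\<omega> \<in> E y" "y \<in> I \<rightarrow>\<^sub>E {1..n}"
      using \<omega> by (simp_all add: E_iff y_def restrict_PiE_iff)
    have uniq: "y = x" if "\<omega> \<in> E x" "x \<in> I \<rightarrow>\<^sub>E {1..n}" for x
      using that y by (intro PiE_ext[of _ I "\<lambda>_. {1..n}"]) (simp_all add: E_iff)
    have "\<omega> \<in> {\<omega> \<in> space M. Q (\<lambda>i\<in>I. X i \<omega>)} \<longleftrightarrow> Q y"
      using \<omega>(1) unfolding y_def by blast
    also have "\<dots> \<longleftrightarrow> \<omega> \<in> (\<Union>x\<in>?S. E x)"
      using y uniq by blast
    finally show "\<omega> \<in> {\<omega> \<in> space M. Q (\<lambda>i\<in>I. X i \<omega>)} \<longleftrightarrow> \<omega> \<in> (\<Union>x\<in>?S. E x)" .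
  qed
  then have "prob {\<omega> \<in> space M. Q (\<lambda>i\<in>I. X i \<omega>)} = prob (\<Union>x\<in>?S. E x)"
    using ev_sets E_sets fin by (intro finite_measure_eq_AE) (auto intro!: sets.finite_UN)
  also have "\<dots> = (\<Sum>x\<in>?S. prob (E x))"
  proof (rule finite_measure_finite_Union[OF fin])
    show "disjoint_family_on E ?S"
      unfolding disjoint_family_on_def
    proof (intro ballI impI, rule ccontr)
      fix x y assume xy: "x \<in> ?S" "y \<in> ?S" "x \<noteq> y" "E x \<inter> E y \<noteq> {}"
      then obtain \<omega> where "\<omega> \<in> E x" "\<omega> \<in> E y" by auto
      then have "\<forall>i\<in>I. x i = y i" by (auto simp: E_iff)
      with xy show False by (auto intro: PiE_ext)
    qed
  qed (use E_sets in auto)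
  also have "\<dots> = box_dens I n Q"
    by (simp add: E_prob box_dens_def)
  finally show ?thesis .
qed

section \<open>Product rule, monotonicity and union bounds for box densities\<close>

text \<open>Independence of the coordinates in counting form: the set counted is itself a Cartesian
  product.\<close>

lemma box_dens_prod:
  assumes "finite I"
  shows "box_dens I n (\<lambda>x. \<forall>i\<in>I. A i (x i)) = (\<Prod>i\<in>I. real (card {k \<in> {1..n}. A i k}) / real n)"
proof -
  have "{x \<in> I \<rightarrow>\<^sub>E {1..n}. \<forall>i\<in>I. A i (x i)} = (\<Pi>\<^sub>E i\<in>I. {k \<in> {1..n}. A i k})"
    by (auto simp: PiE_iff extensional_def)
  then show ?thesis
    using assms by (simp add: box_dens_def card_PiE prod_dividef)
qed

lemma box_dens_cong:
  "(\<And>x. x \<in> I \<rightarrow>\<^sub>E {1..n} \<Longrightarrow> Q x \<longleftrightarrow> R x) \<Longrightarrow> box_dens I n Q = box_dens I n R"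
  unfolding box_dens_def by (metis (mono_tags, lifting) Collect_cong)

lemma box_dens_mono:
  assumes "finite I" "\<And>x. x \<in> I \<rightarrow>\<^sub>E {1..n} \<Longrightarrow> Q x \<Longrightarrow> R x"
  shows "box_dens I n Q \<le> box_dens I n R"
  unfolding box_dens_def using assms
  by (intro divide_right_mono of_nat_mono card_mono) (auto simp: finite_PiE)

lemma box_dens_disj_le:
  assumes "finite I"
  shows "box_dens I n (\<lambda>x. Q x \<or> R x) \<le> box_dens I n Q + box_dens I n R"
proof -
  have "{x \<in> I \<rightarrow>\<^sub>E {1..n}. Q x \<or> R x} = {x \<in> I \<rightarrow>\<^sub>E {1..n}. Q x} \<union> {x \<in> I \<rightarrow>\<^sub>E {1..n}. R x}"
    by auto
  then have "card {x \<in> I \<rightarrow>\<^sub>E {1..n}. Q x \<or> R x} \<le>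
      card {x \<in> I \<rightarrow>\<^sub>E {1..n}. Q x} + card {x \<in> I \<rightarrow>\<^sub>E {1..n}. R x}"
    by (simp only: card_Un_le)
  then have "real (card {x \<in> I \<rightarrow>\<^sub>E {1..n}. Q x \<or> R x}) \<le>
      real (card {x \<in> I \<rightarrow>\<^sub>E {1..n}. Q x}) + real (card {x \<in> I \<rightarrow>\<^sub>E {1..n}. R x})"
    by linarith
  then show ?thesis
    unfolding box_dens_def by (simp add: divide_right_mono flip: add_divide_distrib)
qed

lemma box_dens_ex_le:
  assumes "finite J"
  shows "box_dens I n (\<lambda>x. \<exists>j\<in>J. Q j x) \<le> (\<Sum>j\<in>J. box_dens I n (Q j))"
proof -
  have "{x \<in> I \<rightarrow>\<^sub>E {1..n}. \<exists>j\<in>J. Q j x} = (\<Union>j\<in>J. {x \<in> I \<rightarrow>\<^sub>E {1..n}. Q j x})"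
    by auto
  then have "card {x \<in> I \<rightarrow>\<^sub>E {1..n}. \<exists>j\<in>J. Q j x} \<le> (\<Sum>j\<in>J. card {x \<in> I \<rightarrow>\<^sub>E {1..n}. Q j x})"
    by (simp only: card_UN_le[OF assms])
  then have "real (card {x \<in> I \<rightarrow>\<^sub>E {1..n}. \<exists>j\<in>J. Q j x}) \<le>
      (\<Sum>j\<in>J. real (card {x \<in> I \<rightarrow>\<^sub>E {1..n}. Q j x}))"
    unfolding of_nat_sum[symmetric] of_nat_le_iff .
  then show ?thesis
    unfolding box_dens_def by (simp add: divide_right_mono flip: sum_divide_distrib)
qed

lemma box_dens_ex_unique:
  assumes "finite I" "finite J"
    and "\<And>x i j. i \<in> J \<Longrightarrow> j \<in> J \<Longrightarrow> Q i x \<Longrightarrow> Q j x \<Longrightarrow> i = j"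
  shows "box_dens I n (\<lambda>x. \<exists>j\<in>J. Q j x) = (\<Sum>j\<in>J. box_dens I n (Q j))"
proof -
  have "{x \<in> I \<rightarrow>\<^sub>E {1..n}. \<exists>j\<in>J. Q j x} = (\<Union>j\<in>J. {x \<in> I \<rightarrow>\<^sub>E {1..n}. Q j x})"
    by auto
  also have "card \<dots> = (\<Sum>j\<in>J. card {x \<in> I \<rightarrow>\<^sub>E {1..n}. Q j x})"
    using assms by (intro card_UN_disjoint) (auto simp: finite_PiE)
  finally show ?thesis
    by (simp add: box_dens_def sum_divide_distrib)
qed

section \<open>Densities of divisibility patterns of a single integer\<close>

lemma card_multiples_eq:
  fixes d n :: nat
  assumes "d > 0"
  shows "card {k \<in> {1..n}. d dvd k} = n div d"
proof -
  have "{k \<in> {1..n}. d dvd k} = (\<lambda>m. d * m) ` {1..n div d}"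
  proof (rule equalityI; rule subsetI)
    fix k assume "k \<in> {k \<in> {1..n}. d dvd k}"
    then obtain m where m: "k = d * m" "1 \<le> k" "k \<le> n" by auto
    then have "m \<le> n div d" "m \<ge> 1"
      using assms by (auto simp: less_eq_div_iff_mult_less_eq mult.commute Suc_le_eq)
    with m show "k \<in> (\<lambda>m. d * m) ` {1..n div d}" by auto
  next
    fix k assume "k \<in> (\<lambda>m. d * m) ` {1..n div d}"
    then show "k \<in> {k \<in> {1..n}. d dvd k}"
      using assms by (auto simp: less_eq_div_iff_mult_less_eq mult.commute Suc_le_eq)
  qed
  moreover have "inj_on (\<lambda>m. d * m) {1..n div d}"
    using assms by (auto simp: inj_on_def)
  ultimately show ?thesis by (simp add: card_image)
qed

text \<open>Rounding down in \<open>n div d\<close> only lowers the count. The bound holds for every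
  \<open>n\<close> and not just in the limit, which makes the later tail estimate uniform in
  \<open>n\<close>.\<close>

lemma multiples_density_le:
  fixes d n :: nat
  assumes "d > 0"
  shows "real (card {k \<in> {1..n}. d dvd k}) / real n \<le> 1 / real d"
proof (cases "n = 0")
  case False
  have "real (n div d) \<le> real n / real d" by (rule of_nat_div_le_of_nat)
  then show ?thesis
    using False assms by (simp only: card_multiples_eq) (simp add: field_simps)
qed auto

lemma multiples_density_tendsto:
  fixes d :: nat
  assumes d: "d > 0"
  shows "(\<lambda>n. real (card {k \<in> {1..n}. d dvd k}) / real n) \<longlonglongrightarrow> 1 / real d"
proof (rule real_tendsto_sandwich)
  show "\<forall>\<^sub>F n in sequentially. 1 / real d - 1 / real n \<le> real (card {k \<in> {1..n}. d dvd k}) / real n"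
  proof (rule eventually_sequentiallyI[of 1])
    fix n :: nat assume n: "1 \<le> n"
    have "real n < real ((n div d + 1) * d)"
      unfolding of_nat_less_iff using d by (simp add: dividend_less_div_times)
    then have "real n / real d - real (n div d) \<le> 1"
      using d by (simp add: field_simps)
    then have "(real n / real d - 1) / real n \<le> real (n div d) / real n"
      by (intro divide_right_mono) auto
    then show "1 / real d - 1 / real n \<le> real (card {k \<in> {1..n}. d dvd k}) / real n"
      using n by (simp only: card_multiples_eq[OF d]) (simp add: diff_divide_distrib)
  qed
  show "\<forall>\<^sub>F n in sequentially. real (card {k \<in> {1..n}. d dvd k}) / real n \<le> 1 / real d"
    using multiples_density_le[OF d] by simp
  show "(\<lambda>n. 1 / real d - 1 / real n) \<longlonglongrightarrow> 1 / real d"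
    using tendsto_diff[OF tendsto_const lim_1_over_n, of "1 / real d"] by simp
qed simp

text \<open>Induction on \<open>E\<close>: excluding a further prime \<open>p\<close> subtracts the
  count for \<open>d * p\<close> from the count for \<open>d\<close>, and
  \<open>1/d - 1/(d*p) = 1/d * (1 - 1/p)\<close>. The induction hypothesis is needed for both
  moduli, hence \<open>d\<close> is generalised.\<close>

lemma coprime_multiples_density_tendsto:
  fixes d :: nat
  assumes "finite E" "d > 0" "\<And>p. p \<in> E \<Longrightarrow> prime p \<and> \<not> p dvd d"
  shows "(\<lambda>n. real (card {k \<in> {1..n}. d dvd k \<and> (\<forall>p\<in>E. \<not> p dvd k)}) / real n)
           \<longlonglongrightarrow> 1 / real d * (\<Prod>p\<in>E. 1 - 1 / real p)"
  using assms
proof (induction E arbitrary: d rule: finite_induct)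
  case empty
  then show ?case using multiples_density_tendsto by simp
next
  case (insert p E)
  let ?c = "\<lambda>d n. card {k \<in> {1..n}. d dvd k \<and> (\<forall>p\<in>E. \<not> p dvd k)}"
  have p: "prime p" "\<not> p dvd d" using insert.prems by auto
  \<comment> \<open>This is where \<open>p\<close> not dividing \<open>d\<close> enters: the two are
    coprime, so divisibility by both is divisibility by the product.\<close>
  have dp: "d * p dvd k \<longleftrightarrow> d dvd k \<and> p dvd k" for k
    using p by (metis divides_mult dvd_mult_left dvd_mult_right prime_imp_coprime coprime_commute)
  have card: "card {k \<in> {1..n}. d dvd k \<and> (\<forall>q\<in>insert p E. \<not> q dvd k)} + ?c (d * p) n = ?c d n" for n
  proof (subst card_Un_disjoint[symmetric])
    show "card ({k \<in> {1..n}. d dvd k \<and> (\<forall>q\<in>insert p E. \<not> q dvd k)} \<union>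
        {k \<in> {1..n}. d * p dvd k \<and> (\<forall>p\<in>E. \<not> p dvd k)}) = ?c d n"
      unfolding dp by (intro arg_cong[where f = card]) auto
  qed (auto simp: dp)
  have "(\<lambda>n. real (?c d n) / real n - real (?c (d * p) n) / real n) \<longlonglongrightarrow>
      1 / real d * (\<Prod>p\<in>E. 1 - 1 / real p) - 1 / real (d * p) * (\<Prod>p\<in>E. 1 - 1 / real p)"
  proof (intro tendsto_diff insert.IH)
    show "d > 0" "d * p > 0" using insert.prems p by (auto simp: prime_gt_0_nat)
    fix q assume q: "q \<in> E"
    then have "prime q" "\<not> q dvd d" "q \<noteq> p" using insert by auto
    then show "prime q \<and> \<not> q dvd d" "prime q \<and> \<not> q dvd d * p"
      using p by (auto simp: prime_dvd_mult_iff primes_dvd_imp_eq)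
  qed
  moreover have "real (?c d n) / real n - real (?c (d * p) n) / real n =
      real (card {k \<in> {1..n}. d dvd k \<and> (\<forall>q\<in>insert p E. \<not> q dvd k)}) / real n" for n
    by (simp only: card[symmetric] of_nat_add) (simp add: add_divide_distrib)
  moreover have "1 / real d * (\<Prod>p\<in>E. 1 - 1 / real p) - 1 / real (d * p) * (\<Prod>p\<in>E. 1 - 1 / real p)
      = 1 / real d * (\<Prod>p\<in>insert p E. 1 - 1 / real p)"
    using insert.hyps by (simp add: algebra_simps)
  ultimately show ?case by simp
qed

lemma prod_primes_dvd_iff:
  fixes k :: nat
  assumes "finite S" "\<And>p. p \<in> S \<Longrightarrow> prime p"
  shows "\<Prod>S dvd k \<longleftrightarrow> (\<forall>p\<in>S. p dvd k)"
  using assms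
proof (induction S rule: finite_induct)
  case (insert p S)
  have "coprime p (\<Prod>S)"
    using insert by (intro prod_coprime_right) (auto intro: primes_coprime)
  then have "p * \<Prod>S dvd k \<longleftrightarrow> p dvd k \<and> \<Prod>S dvd k"
    by (metis divides_mult dvd_mult_left dvd_mult_right)
  with insert show ?case by simp
qed auto

text \<open>Asymptotic independence of divisibility by different primes. The primes in
  \<open>P \<inter> S\<close> are merged into one modulus, their product, and those in
  \<open>P - S\<close> are excluded.\<close>

lemma prime_pattern_density_tendsto:
  assumes P: "finite P" "\<And>p. p \<in> P \<Longrightarrow> prime p"
  shows "(\<lambda>n. real (card {k \<in> {1..n}. \<forall>p\<in>P. p dvd k \<longleftrightarrow> p \<in> S}) / real n)
           \<longlonglongrightarrow> (\<Prod>p\<in>P. if p \<in> S then 1 / real p else 1 - 1 / real p)"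
proof -
  let ?d = "\<Prod>(P \<inter> S)"
  have "\<not> p dvd ?d" if p: "p \<in> P - S" for p
  proof
    assume "p dvd ?d"
    then obtain q where "q \<in> P \<inter> S" "p dvd q"
      using p P by (auto simp: prime_dvd_prod_iff)
    with p P show False by (metis DiffE IntE primes_dvd_imp_eq)
  qed
  moreover have "?d > 0"
    using P by (intro prod_pos) (auto simp: prime_gt_0_nat)
  ultimately have lim: "(\<lambda>n. real (card {k \<in> {1..n}. ?d dvd k \<and> (\<forall>p\<in>P - S. \<not> p dvd k)}) / real n)
           \<longlonglongrightarrow> 1 / real ?d * (\<Prod>p\<in>P - S. 1 - 1 / real p)"
    using P by (intro coprime_multiples_density_tendsto) auto
  have iff: "(?d dvd k \<and> (\<forall>p\<in>P - S. \<not> p dvd k)) = (\<forall>p\<in>P. p dvd k \<longleftrightarrow> p \<in> S)" for k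
    using P by (subst prod_primes_dvd_iff) auto
  have weight: "1 / real ?d * (\<Prod>p\<in>P - S. 1 - 1 / real p) =
      (\<Prod>p\<in>P. if p \<in> S then 1 / real p else 1 - 1 / real p)"
    using P by (subst prod.If_cases) (auto simp: prod_dividef Diff_eq)
  show ?thesis
    using lim unfolding iff weight .
qed

section \<open>Sieving by local conditions\<close>

definition div_set :: "'i set \<Rightarrow> nat \<Rightarrow> ('i \<Rightarrow> nat) \<Rightarrow> 'i set" where
  "div_set I p x = {i \<in> I. p dvd x i}"

text \<open>The limiting probability that the coordinates divisible by \<open>p\<close> are indexed by a member of \<open>F\<close>.\<close>

definition local_dens :: "'i set \<Rightarrow> nat \<Rightarrow> 'i set set \<Rightarrow> real" where
  "local_dens I p F = (\<Sum>b\<in>F. \<Prod>i\<in>I. if i \<in> b then 1 / real p else 1 - 1 / real p)"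

text \<open>The event is split according to the exact pattern \<open>B p\<close> that occurs at each
  prime. For fixed \<open>B\<close> the condition decouples: coordinate \<open>i\<close> must be
  divisible by exactly those \<open>p\<close> in \<open>P\<close> with \<open>i \<in> B p\<close>.
  This turns the density into a finite sum of products of one-coordinate densities.\<close>

lemma box_dens_local_conditions_tendsto:
  fixes F :: "nat \<Rightarrow> 'i set set"
  assumes I: "finite I" and P: "finite P" "\<And>p. p \<in> P \<Longrightarrow> prime p"
    and F: "\<And>p. p \<in> P \<Longrightarrow> F p \<subseteq> Pow I"
  shows "(\<lambda>n. box_dens I n (\<lambda>x. \<forall>p\<in>P. div_set I p x \<in> F p))
           \<longlonglongrightarrow> (\<Prod>p\<in>P. local_dens I p (F p))"
proof -
  have finF: "finite (F p)" if "p \<in> P" for p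
    using F[OF that] I by (meson finite_Pow_iff finite_subset)
  have eq: "box_dens I n (\<lambda>x. \<forall>p\<in>P. div_set I p x \<in> F p) =
      (\<Sum>B\<in>PiE P F. \<Prod>i\<in>I. real (card {k \<in> {1..n}. \<forall>p\<in>P. p dvd k \<longleftrightarrow> p \<in> {p. i \<in> B p}}) / real n)" for n
  proof -
    have "box_dens I n (\<lambda>x. \<forall>p\<in>P. div_set I p x \<in> F p) =
        box_dens I n (\<lambda>x. \<exists>B\<in>PiE P F. \<forall>p\<in>P. div_set I p x = B p)"
    proof (rule box_dens_cong)
      fix x :: "'i \<Rightarrow> nat"
      show "(\<forall>p\<in>P. div_set I p x \<in> F p) \<longleftrightarrow> (\<exists>B\<in>PiE P F. \<forall>p\<in>P. div_set I p x = B p)"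
      proof
        assume "\<forall>p\<in>P. div_set I p x \<in> F p"
        then have "(\<lambda>p\<in>P. div_set I p x) \<in> PiE P F" by (simp add: restrict_PiE_iff)
        then show "\<exists>B\<in>PiE P F. \<forall>p\<in>P. div_set I p x = B p" by (rule rev_bexI) simp
      next
        assume "\<exists>B\<in>PiE P F. \<forall>p\<in>P. div_set I p x = B p"
        then show "\<forall>p\<in>P. div_set I p x \<in> F p" by (metis PiE_mem)
      qed
    qed
    also have "\<dots> = (\<Sum>B\<in>PiE P F. box_dens I n (\<lambda>x. \<forall>p\<in>P. div_set I p x = B p))"
    \<comment> \<open>Functions in \<open>PiE P F\<close> are determined by their values on
      \<open>P\<close>, so different choices of \<open>B\<close> give disjoint events.\<close>
    proof (rule box_dens_ex_unique)
      fix x and B C assume "B \<in> PiE P F" "C \<in> PiE P F"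
        "\<forall>p\<in>P. div_set I p x = B p" "\<forall>p\<in>P. div_set I p x = C p"
      then show "B = C" by (intro PiE_ext[of B P F C]) auto
    qed (use I P finF in \<open>auto intro: finite_PiE\<close>)
    also have "\<dots> = (\<Sum>B\<in>PiE P F. \<Prod>i\<in>I. real (card {k \<in> {1..n}. \<forall>p\<in>P. p dvd k \<longleftrightarrow> p \<in> {p. i \<in> B p}}) / real n)"
    proof (rule sum.cong[OF refl])
      fix B assume B: "B \<in> PiE P F"
      have "B p \<subseteq> I" if "p \<in> P" for p
        using that B F PiE_mem by blast
      then have "(\<forall>p\<in>P. div_set I p x = B p) \<longleftrightarrow> (\<forall>i\<in>I. \<forall>p\<in>P. p dvd x i \<longleftrightarrow> p \<in> {p. i \<in> B p})" for x
        unfolding div_set_def by blast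
      then show "box_dens I n (\<lambda>x. \<forall>p\<in>P. div_set I p x = B p) =
          (\<Prod>i\<in>I. real (card {k \<in> {1..n}. \<forall>p\<in>P. p dvd k \<longleftrightarrow> p \<in> {p. i \<in> B p}}) / real n)"
        using box_dens_prod[OF I, of n "\<lambda>i k. \<forall>p\<in>P. p dvd k \<longleftrightarrow> p \<in> {p. i \<in> B p}"] by simp
    qed
    finally show ?thesis .
  qed
  \<comment> \<open>The distributive law expands the product of local sums over all choices of
    \<open>B\<close>. Exchanging the two products then matches the termwise limits in
    \<open>eq\<close>.\<close>
  have "(\<Prod>p\<in>P. local_dens I p (F p)) =
      (\<Sum>B\<in>PiE P F. \<Prod>p\<in>P. \<Prod>i\<in>I. if i \<in> B p then 1 / real p else 1 - 1 / real p)"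
    unfolding local_dens_def using P finF by (intro prod_sum_PiE) auto
  also have "\<dots> = (\<Sum>B\<in>PiE P F. \<Prod>i\<in>I. \<Prod>p\<in>P. if p \<in> {p. i \<in> B p} then 1 / real p else 1 - 1 / real p)"
    by (subst prod.swap) simp
  finally have rhs: "(\<Prod>p\<in>P. local_dens I p (F p)) = \<dots>" .
  show ?thesis
    unfolding eq rhs using P by (intro tendsto_sum tendsto_prod prime_pattern_density_tendsto)
qed

section \<open>The contribution of large primes\<close>

lemma box_dens_two_multiples_le:
  assumes I: "finite I" "i \<in> I" "j \<in> I" "i \<noteq> j" and p: "p > 0"
  shows "box_dens I n (\<lambda>x. p dvd x i \<and> p dvd x j) \<le> 1 / real p ^ 2"
proof -
  \<comment> \<open>The condition on two coordinates is padded with void conditions on the others to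
    fit the product rule. A void condition contributes a factor of at most 1.\<close>
  have "box_dens I n (\<lambda>x. p dvd x i \<and> p dvd x j) =
      box_dens I n (\<lambda>x. \<forall>k\<in>I. k \<in> {i, j} \<longrightarrow> p dvd x k)"
    using I by (intro box_dens_cong) auto
  also have "\<dots> = (\<Prod>k\<in>I. real (card {m \<in> {1..n}. k \<in> {i, j} \<longrightarrow> p dvd m}) / real n)"
    using I(1) by (rule box_dens_prod)
  also have "\<dots> \<le> (\<Prod>k\<in>I. if k \<in> {i, j} then 1 / real p else 1)"
  proof (rule prod_mono, intro conjI)
    fix k assume "k \<in> I"
    show "real (card {m \<in> {1..n}. k \<in> {i, j} \<longrightarrow> p dvd m}) / real n
        \<le> (if k \<in> {i, j} then 1 / real p else 1)"
    proof (cases "k \<in> {i, j}")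
      case True
      then show ?thesis using multiples_density_le[OF p, of n] by (simp only: if_True simp_thms)
    next
      case False
      then have "{m \<in> {1..n}. k \<in> {i, j} \<longrightarrow> p dvd m} = {1..n}" by auto
      then have "real (card {m \<in> {1..n}. k \<in> {i, j} \<longrightarrow> p dvd m}) / real n \<le> 1" by simp
      then show ?thesis using False by (simp only: if_False)
    qed
  qed auto
  also have "\<dots> = (1 / real p) ^ card (I \<inter> {i, j})"
    using prod.inter_restrict[OF I(1), of "\<lambda>_. 1 / real p" "{i, j}"] by simp
  also have "I \<inter> {i, j} = {i, j}" using I by auto
  finally show ?thesis using I by (simp add: power2_eq_square)
qed

text \<open>The bound is free of \<open>n\<close>. Adding the terms below \<open>N\<close> to both
  sides reduces it to comparing a finite subsum with the whole series of nonnegative terms.\<close>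

lemma sum_inverse_squares_le_tail:
  fixes N n :: nat
  shows "(\<Sum>p=N..n. 1 / real p ^ 2) \<le> (\<Sum>k. 1 / real (k + N) ^ 2)"
proof -
  have s: "summable (\<lambda>k. 1 / real k ^ 2)"
    using inverse_power_summable[of 2, where 'a = real] by (simp add: inverse_eq_divide)
  have "(\<Sum>k<N. 1 / real k ^ 2) + (\<Sum>p=N..n. 1 / real p ^ 2) = (\<Sum>k\<in>{..<N} \<union> {N..n}. 1 / real k ^ 2)"
    by (rule sum.union_disjoint[symmetric]) auto
  also have "\<dots> \<le> (\<Sum>k. 1 / real k ^ 2)"
    by (rule sum_le_suminf[OF s]) auto
  finally show ?thesis
    using suminf_split_initial_segment[OF s, of N] by simp
qed

text \<open>Union bound over the divisor and over ordered pairs of distinct indices. A divisor of a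
  positive coordinate is at most \<open>n\<close>, so finitely many candidates suffice. Primality is
  discarded, since the sum over all integers already converges.\<close>

lemma box_dens_large_prime_le:
  assumes I: "finite I" and N: "N > 0"
  shows "box_dens I n (\<lambda>x. \<exists>p. prime p \<and> p \<ge> N \<and> (\<exists>i\<in>I. \<exists>j\<in>I. i \<noteq> j \<and> p dvd x i \<and> p dvd x j))
           \<le> real (card I) ^ 2 * (\<Sum>k. 1 / real (k + N) ^ 2)"
proof -
  let ?D = "{(i, j) \<in> I \<times> I. i \<noteq> j}"
  let ?J = "{N..n} \<times> ?D"
  have finD: "finite ?D"
    using I by (intro finite_subset[of ?D "I \<times> I"]) auto
  have cardD: "card ?D \<le> card I ^ 2"
    using I card_mono[of "I \<times> I" ?D] by (auto simp: card_cartesian_product power2_eq_square)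
  have "box_dens I n (\<lambda>x. \<exists>p. prime p \<and> p \<ge> N \<and> (\<exists>i\<in>I. \<exists>j\<in>I. i \<noteq> j \<and> p dvd x i \<and> p dvd x j))
      \<le> box_dens I n (\<lambda>x. \<exists>t\<in>?J. fst t dvd x (fst (snd t)) \<and> fst t dvd x (snd (snd t)))"
  proof (rule box_dens_mono[OF I])
    fix x assume x: "x \<in> I \<rightarrow>\<^sub>E {1..n}"
    assume "\<exists>p. prime p \<and> p \<ge> N \<and> (\<exists>i\<in>I. \<exists>j\<in>I. i \<noteq> j \<and> p dvd x i \<and> p dvd x j)"
    then obtain p i j where p: "p \<ge> N" "i \<in> I" "j \<in> I" "i \<noteq> j" "p dvd x i" "p dvd x j" by blast
    moreover have "p \<le> x i" "x i \<le> n"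
      using p x by (auto simp: PiE_iff intro!: dvd_imp_le)
    ultimately show "\<exists>t\<in>?J. fst t dvd x (fst (snd t)) \<and> fst t dvd x (snd (snd t))"
      by (intro bexI[of _ "(p, i, j)"]) auto
  qed
  also have "\<dots> \<le> (\<Sum>t\<in>?J. box_dens I n (\<lambda>x. fst t dvd x (fst (snd t)) \<and> fst t dvd x (snd (snd t))))"
    using finD by (intro box_dens_ex_le) simp
  also have "\<dots> \<le> (\<Sum>t\<in>?J. 1 / real (fst t) ^ 2)"
    using I N by (intro sum_mono box_dens_two_multiples_le) auto
  also have "\<dots> = (\<Sum>p=N..n. \<Sum>d\<in>?D. 1 / real p ^ 2)"
    by (subst sum.cartesian_product) (simp add: case_prod_unfold)
  also have "\<dots> = real (card ?D) * (\<Sum>p=N..n. 1 / real p ^ 2)"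
    by (simp add: sum_distrib_left)
  also have "\<dots> \<le> real (card I) ^ 2 * (\<Sum>k. 1 / real (k + N) ^ 2)"
    using cardD sum_inverse_squares_le_tail[of N n]
    by (intro mult_mono sum_nonneg) (simp_all flip: of_nat_power)
  finally show ?thesis .
qed

text \<open>Interchange of limits. In the application \<open>Q N n\<close> is the density for the
  primes below \<open>N\<close>, \<open>\<delta> N\<close> the finite product of local densities,
  and \<open>\<epsilon> N\<close> a tail bound independent of \<open>n\<close>.\<close>

lemma tendsto_of_uniform_approximation:
  fixes P :: "nat \<Rightarrow> real"
  assumes Q: "\<And>N. Q N \<longlonglongrightarrow> \<delta> N" and \<delta>: "\<delta> \<longlonglongrightarrow> L" and \<epsilon>: "\<epsilon> \<longlonglongrightarrow> 0"
    and close: "\<And>N n. N \<ge> N0 \<Longrightarrow> \<bar>P n - Q N n\<bar> \<le> \<epsilon> N"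
  shows "P \<longlonglongrightarrow> L"
proof (rule swap_uniform_limit')
  show "\<forall>\<^sub>F N in sequentially. Q N \<longlonglongrightarrow> \<delta> N"
    using Q by simp
  show "\<delta> \<longlonglongrightarrow> L" by fact
  show "uniform_limit UNIV Q P sequentially"
  proof (rule uniform_limitI)
    fix e :: real assume "e > 0"
    then have "\<forall>\<^sub>F N in sequentially. \<epsilon> N < e"
      using \<epsilon> by (rule order_tendstoD(2)[rotated])
    moreover have "\<forall>\<^sub>F N in sequentially. N \<ge> N0" by (rule eventually_ge_at_top)
    ultimately show "\<forall>\<^sub>F N in sequentially. \<forall>n\<in>UNIV. dist (Q N n) (P n) < e"
    proof eventually_elim
      case (elim N)
      have "dist (Q N n) (P n) < e" for n
        using close[OF elim(2), of n] elim(1) by (simp add: dist_real_def abs_minus_commute)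
      then show ?case by blast
    qed
  qed
qed (auto simp: eventually_sequentially)

text \<open>Hypothesis \<open>big\<close> says that a violation at a large prime requires it to
  divide two coordinates, so the error of truncating at \<open>N\<close> is controlled by the
  large-prime bound. Both coprimality problems are instances, with different
  \<open>F\<close>.\<close>

theorem box_dens_prime_sieve_tendsto:
  fixes F :: "nat \<Rightarrow> 'i set set"
  assumes I: "finite I" and F: "\<And>p. prime p \<Longrightarrow> F p \<subseteq> Pow I"
    and big: "\<And>p b. prime p \<Longrightarrow> p \<ge> N0 \<Longrightarrow> b \<subseteq> I \<Longrightarrow> b \<notin> F p \<Longrightarrow> \<exists>i\<in>b. \<exists>j\<in>b. i \<noteq> j"
    and L: "(\<lambda>N. \<Prod>p | prime p \<and> p < N. local_dens I p (F p)) \<longlonglongrightarrow> L"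
  shows "(\<lambda>n. box_dens I n (\<lambda>x. \<forall>p. prime p \<longrightarrow> div_set I p x \<in> F p)) \<longlonglongrightarrow> L"
proof (rule tendsto_of_uniform_approximation[OF _ L])
  fix N
  show "(\<lambda>n. box_dens I n (\<lambda>x. \<forall>p\<in>{p. prime p \<and> p < N}. div_set I p x \<in> F p))
          \<longlonglongrightarrow> (\<Prod>p | prime p \<and> p < N. local_dens I p (F p))"
    using I F by (intro box_dens_local_conditions_tendsto) auto
next
  have "(\<lambda>N. \<Sum>k. 1 / real (k + N) ^ 2) \<longlonglongrightarrow> 0"
    using inverse_power_summable[of 2, where 'a = real]
    by (intro suminf_exist_split2) (simp add: inverse_eq_divide)
  then show "(\<lambda>N. real (card I) ^ 2 * (\<Sum>k. 1 / real (k + N) ^ 2)) \<longlonglongrightarrow> 0"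
    by (rule tendsto_mult_right_zero)
next
  \<comment> \<open>\<open>N0\<close> makes \<open>big\<close> applicable, and 1 provides the
    positivity of \<open>N\<close> demanded by the tail bound.\<close>
  fix N n :: nat assume N: "max 1 N0 \<le> N"
  let ?good = "\<lambda>x. \<forall>p. prime p \<longrightarrow> div_set I p x \<in> F p"
  let ?good_below = "\<lambda>x. \<forall>p\<in>{p. prime p \<and> p < N}. div_set I p x \<in> F p"
  let ?tail = "\<lambda>x. \<exists>p. prime p \<and> p \<ge> N \<and> (\<exists>i\<in>I. \<exists>j\<in>I. i \<noteq> j \<and> p dvd x i \<and> p dvd x j)"
  have "box_dens I n ?good \<le> box_dens I n ?good_below"
    using I by (rule box_dens_mono) auto
  moreover have "box_dens I n ?good_below \<le> box_dens I n (\<lambda>x. ?good x \<or> ?tail x)"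
  proof (rule box_dens_mono[OF I])
    fix x assume below: "?good_below x"
    show "?good x \<or> ?tail x"
    proof (cases "?good x")
      case False
      then obtain p where p: "prime p" "div_set I p x \<notin> F p" by blast
      with below have "\<not> p < N" by blast
      then have "p \<ge> N" by simp
      have "\<exists>i\<in>div_set I p x. \<exists>j\<in>div_set I p x. i \<noteq> j"
        using p \<open>p \<ge> N\<close> N by (intro big) (auto simp: div_set_def)
      then have "?tail x"
        using p(1) \<open>p \<ge> N\<close> unfolding div_set_def by blast
      then show ?thesis ..
    qed auto
  qed
  moreover have "\<dots> \<le> box_dens I n ?good + box_dens I n ?tail"
    using I by (rule box_dens_disj_le)
  moreover have "box_dens I n ?tail \<le> real (card I) ^ 2 * (\<Sum>k. 1 / real (k + N) ^ 2)"
    using I N by (intro box_dens_large_prime_le) auto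
  ultimately show "\<bar>box_dens I n ?good - box_dens I n ?good_below\<bar>
      \<le> real (card I) ^ 2 * (\<Sum>k. 1 / real (k + N) ^ 2)"
    by linarith
qed

section \<open>Euler product and local densities\<close>

text \<open>Unordered summation allows the series to be restricted to arbitrary sets of integers, as
  sieving requires.\<close>

lemma has_sum_riemann_zeta:
  assumes "r \<ge> 2"
  shows "((\<lambda>n. 1 / real n ^ r) has_sum riemann_zeta (real r)) {0<..}"
proof -
  let ?f = "\<lambda>n. 1 / real n ^ r"
  have s: "summable ?f"
    using inverse_power_summable[OF assms, where 'a = real] by (simp add: inverse_eq_divide)
  have "riemann_zeta (real r) = (\<Sum>n. ?f (Suc n))"
    unfolding riemann_zeta_def by (intro suminf_cong) (simp only: powr_realpow of_nat_0_less_iff zero_less_Suc)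
  \<comment> \<open>The added term at 0 is \<open>1 / 0 ^ r\<close>, which is 0 by the convention
    for division by zero.\<close>
  also have "\<dots> = suminf ?f"
    using suminf_split_head[OF s] assms by simp
  finally have "?f sums riemann_zeta (real r)"
    using s by (simp add: summable_sums)
  then have "(?f has_sum riemann_zeta (real r)) UNIV"
    using s by (intro norm_summable_imp_has_sum) simp_all
  then show ?thesis
    using assms by (subst has_sum_cong_neutral[where T = UNIV and g = ?f]) auto
qed

text \<open>Sieve of Eratosthenes. The multiples of a new prime \<open>p\<close> inside the
  remaining set \<open>?A\<close> are exactly \<open>p\<close> times \<open>?A\<close>, because
  \<open>p\<close> differs from the primes already sieved. Removing them multiplies the sum by
  \<open>1 - 1/p^r\<close>.\<close>

lemma infsum_coprime_part:
  assumes r: "r \<ge> 2" and P: "finite P" "\<And>p. p \<in> P \<Longrightarrow> prime p"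
  shows "infsum (\<lambda>n. 1 / real n ^ r) {n \<in> {0<..}. \<forall>p\<in>P. \<not> p dvd n} =
           riemann_zeta (real r) * (\<Prod>p\<in>P. 1 - 1 / real p ^ r)"
  using P
proof (induction P rule: finite_induct)
  case empty
  then show ?case
    using infsumI[OF has_sum_riemann_zeta[OF r]] by (simp add: greaterThan_def)
next
  case (insert p P)
  let ?f = "\<lambda>n. 1 / real n ^ r"
  let ?A = "{n \<in> {0<..}. \<forall>p\<in>P. \<not> p dvd n}"
  have p: "prime p" "p > 0" using insert.prems by (auto simp: prime_gt_0_nat)
  have dvd_iff: "q dvd p * n \<longleftrightarrow> q dvd n" if "q \<in> P" for q n
    using that insert p by (metis insertCI prime_dvd_mult_iff primes_dvd_imp_eq)
  have sub: "(*) p ` ?A \<subseteq> ?A"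
    using p dvd_iff by auto
  have summable: "?f summable_on B" if "B \<subseteq> {0<..}" for B
    using has_sum_riemann_zeta[OF r] that
    by (meson has_sum_imp_summable summable_on_subset_banach)
  have "{n \<in> {0<..}. \<forall>q\<in>insert p P. \<not> q dvd n} = ?A - (*) p ` ?A"
  proof (rule equalityI; rule subsetI)
    fix n assume n: "n \<in> ?A - (*) p ` ?A"
    have "\<not> p dvd n"
    proof
      assume "p dvd n"
      then obtain m where m: "n = p * m" ..
      with n dvd_iff have "m \<in> ?A" by auto
      with n m show False by auto
    qed
    with n show "n \<in> {n \<in> {0<..}. \<forall>q\<in>insert p P. \<not> q dvd n}" by auto
  qed auto
  then have "infsum ?f {n \<in> {0<..}. \<forall>q\<in>insert p P. \<not> q dvd n} = infsum ?f ?A - infsum ?f ((*) p ` ?A)"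
    using sub by (simp only:) (intro infsum_Diff summable; auto)
  also have "infsum ?f ((*) p ` ?A) = infsum (\<lambda>n. 1 / real p ^ r * ?f n) ?A"
    using p by (subst infsum_reindex) (auto simp: inj_on_def o_def power_mult_distrib)
  also have "\<dots> = 1 / real p ^ r * infsum ?f ?A"
    by (rule infsum_cmult_right')
  finally show ?case
    using insert by (simp add: algebra_simps)
qed

text \<open>After sieving by the primes below \<open>N\<close>, the integer 1 survives and every
  other survivor is at least \<open>N\<close>. The surviving sum therefore lies between 1 and 1 plus
  a tail of the zeta series.\<close>

lemma euler_product_tendsto:
  assumes r: "r \<ge> 2"
  shows "(\<lambda>N. \<Prod>p | prime p \<and> p < N. 1 - 1 / real p ^ r) \<longlonglongrightarrow> 1 / riemann_zeta (real r)"
proof -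
  let ?f = "\<lambda>n. 1 / real n ^ r"
  let ?Z = "riemann_zeta (real r)"
  let ?A = "\<lambda>N. {n \<in> {0<..}. \<forall>p\<in>{p. prime p \<and> p < N}. \<not> p dvd n}"
  have summable: "?f summable_on B" if "B \<subseteq> {0<..}" for B
    using has_sum_riemann_zeta[OF r] that
    by (meson has_sum_imp_summable summable_on_subset_banach)
  have Z: "infsum ?f {0<..} = ?Z"
    using has_sum_riemann_zeta[OF r] by (rule infsumI)
  have "infsum ?f {1} \<le> infsum ?f {0<..}"
    by (intro infsum_mono2 summable) auto
  then have Z1: "?Z \<ge> 1" by (simp add: Z)
  have lower: "1 \<le> infsum ?f (?A N)" for N
  proof -
    have "infsum ?f {1} \<le> infsum ?f (?A N)"
      by (intro infsum_mono2 summable) auto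
    then show ?thesis by simp
  qed
  have upper: "infsum ?f (?A N) \<le> 1 + (?Z - (\<Sum>n\<in>{0<..<N}. ?f n))" for N
  proof -
    have "?A N \<subseteq> insert 1 ({0<..} - {0<..<N})"
    proof
      fix n assume n: "n \<in> ?A N"
      show "n \<in> insert 1 ({0<..} - {0<..<N})"
      proof (cases "n = 1")
        case False
        then obtain p where "prime p" "p dvd n" using prime_factor_nat by blast
        with n have "p \<ge> N" "p \<le> n" by (auto intro: dvd_imp_le simp: not_less[symmetric])
        with n show ?thesis by auto
      qed auto
    qed
    \<comment> \<open>Removing 1 makes the union disjoint; it changes the second set only when
      \<open>N\<close> is at most 1.\<close>
    then have "infsum ?f (?A N) \<le> infsum ?f ({1} \<union> ({0<..} - {0<..<N} - {1}))"
      by (intro infsum_mono2 summable) auto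
    also have "\<dots> = 1 + infsum ?f ({0<..} - {0<..<N} - {1})"
      by (subst infsum_Un_disjoint) (auto intro!: summable)
    also have "infsum ?f ({0<..} - {0<..<N} - {1}) \<le> infsum ?f ({0<..} - {0<..<N})"
      by (intro infsum_mono2 summable) auto
    also have "\<dots> = ?Z - (\<Sum>n\<in>{0<..<N}. ?f n)"
      by (subst infsum_Diff) (auto intro!: summable simp: Z)
    finally show ?thesis by simp
  qed
  have sums: "(\<lambda>N. \<Sum>n\<in>{0<..<N}. ?f n) \<longlonglongrightarrow> ?Z"
  proof -
    have "(?f has_sum ?Z) UNIV"
      using has_sum_riemann_zeta[OF r] r
      by (subst has_sum_cong_neutral[where T = "{0<..}" and g = ?f]) auto
    then have "(\<lambda>N. \<Sum>n<N. ?f n) \<longlonglongrightarrow> ?Z"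
      using has_sum_imp_sums by (simp add: sums_def)
    moreover have "(\<Sum>n<N. ?f n) = (\<Sum>n\<in>{0<..<N}. ?f n)" for N
      using r by (intro sum.mono_neutral_right) auto
    ultimately show ?thesis by simp
  qed
  have "(\<lambda>N. infsum ?f (?A N)) \<longlonglongrightarrow> 1"
  proof (rule real_tendsto_sandwich[where f = "\<lambda>_. 1"])
    show "(\<lambda>N. 1 + (?Z - (\<Sum>n\<in>{0<..<N}. ?f n))) \<longlonglongrightarrow> 1"
      using tendsto_add[OF tendsto_const tendsto_diff[OF tendsto_const sums], of 1 ?Z] by simp
  qed (use lower upper in \<open>simp_all del: mem_Collect_eq\<close>)
  then have "(\<lambda>N. infsum ?f (?A N) / ?Z) \<longlonglongrightarrow> 1 / ?Z"
    using Z1 by (intro tendsto_divide tendsto_const) auto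
  moreover have "infsum ?f (?A N) / ?Z = (\<Prod>p | prime p \<and> p < N. 1 - 1 / real p ^ r)" for N
    using Z1 r by (subst infsum_coprime_part) auto
  ultimately show ?thesis
    by simp
qed

section \<open>Local densities of the families of patterns that occur\<close>

text \<open>The indices in \<open>J\<close> are unconstrained and contribute
  \<open>1/p + (1 - 1/p) = 1\<close> each; those outside \<open>J\<close> must avoid
  \<open>p\<close>.\<close>

lemma local_dens_Pow:
  assumes "finite I" "J \<subseteq> I"
  shows "local_dens I p (Pow J) = (1 - 1 / real p) ^ card (I - J)"
proof -
  have "local_dens I p (Pow J) =
      (\<Sum>b\<in>Pow J. (\<Prod>i\<in>b. 1 / real p) * (\<Prod>i\<in>J - b. 1 - 1 / real p) * (\<Prod>i\<in>I - J. 1 - 1 / real p))"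
    unfolding local_dens_def
  proof (rule sum.cong[OF refl])
    fix b assume b: "b \<in> Pow J"
    then have fin: "finite J" "b \<subseteq> J" using assms by (auto intro: finite_subset)
    let ?w = "\<lambda>i. if i \<in> b then 1 / real p else 1 - 1 / real p"
    have "prod ?w I = prod ?w b * prod ?w (J - b) * prod ?w (I - J)"
      using prod.subset_diff[OF assms(2,1), of ?w] prod.subset_diff[OF fin(2,1), of ?w]
      by (simp only: mult.commute)
    also have "prod ?w (I - J) = (\<Prod>i\<in>I - J. 1 - 1 / real p)"
      using b by (intro prod.cong) auto
    finally show "prod ?w I =
        (\<Prod>i\<in>b. 1 / real p) * (\<Prod>i\<in>J - b. 1 - 1 / real p) * (\<Prod>i\<in>I - J. 1 - 1 / real p)"
      by simp
  qed
  also have "\<dots> = (\<Sum>b\<in>Pow J. (\<Prod>i\<in>b. 1 / real p) * (\<Prod>i\<in>J - b. 1 - 1 / real p)) * (1 - 1 / real p) ^ card (I - J)"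
    by (simp add: sum_distrib_right)
  also have "(\<Sum>b\<in>Pow J. (\<Prod>i\<in>b. 1 / real p) * (\<Prod>i\<in>J - b. 1 - 1 / real p)) = (\<Prod>i\<in>J. 1 / real p + (1 - 1 / real p))"
    using assms by (intro prod_add[symmetric]) (auto intro: finite_subset)
  finally show ?thesis by simp
qed

text \<open>Complementary event: all patterns together have density 1, and the removed one means
  that \<open>p\<close> divides every coordinate.\<close>

lemma local_dens_Pow_minus_whole:
  assumes "finite I"
  shows "local_dens I p (Pow I - {I}) = 1 - 1 / real p ^ card I"
proof -
  have "local_dens I p (Pow I) = local_dens I p (Pow I - {I}) + (\<Prod>i\<in>I. 1 / real p)"
    unfolding local_dens_def using assms by (subst sum.remove[of _ I]) auto
  then show ?thesis
    using assms by (simp add: local_dens_Pow power_one_over)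
qed

text \<open>The two terms come from the empty pattern and from the singletons. For
  \<open>J = I\<close> this is the factor of \<open>T\<close> at \<open>p\<close>, with
  \<open>r = card I\<close>.\<close>

lemma local_dens_at_most_one:
  assumes "finite I" "J \<subseteq> I"
  shows "local_dens I p (insert {} ((\<lambda>i. {i}) ` J)) =
           (1 - 1 / real p) ^ card I + real (card J) / real p * (1 - 1 / real p) ^ (card I - 1)"
proof -
  have J: "finite J" using assms finite_subset by blast
  have "(\<Prod>k\<in>I. if k \<in> {i} then 1 / real p else 1 - 1 / real p) = 1 / real p * (1 - 1 / real p) ^ (card I - 1)"
    if "i \<in> J" for i
  proof -
    have i: "i \<in> I" using that assms by auto
    have "(\<Prod>k\<in>I - {i}. if k \<in> {i} then 1 / real p else 1 - 1 / real p) = (\<Prod>k\<in>I - {i}. 1 - 1 / real p)"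
      by (intro prod.cong) auto
    then show ?thesis
      using i assms by (subst prod.remove[of _ i]) (auto simp: card_Diff_singleton)
  qed
  then have "(\<Sum>b\<in>(\<lambda>i. {i}) ` J. \<Prod>k\<in>I. if k \<in> b then 1 / real p else 1 - 1 / real p) =
      (\<Sum>i\<in>J. 1 / real p * (1 - 1 / real p) ^ (card I - 1))"
    by (subst sum.reindex) (auto intro!: sum.cong)
  moreover have "{} \<notin> (\<lambda>i. {i}) ` J" by auto
  ultimately show ?thesis
    unfolding local_dens_def using J by (subst sum.insert) auto
qed

section \<open>Coprime tuples\<close>

text \<open>Here \<open>u\<close> stands for \<open>1/p\<close> and \<open>Suc m\<close> for
  \<open>r\<close>. The factor equals \<open>(1-u)^m * (1 + m*u)\<close>, whose first-order terms in
  \<open>u\<close> cancel; the quadratic deviation from 1 is what makes the product over primes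
  converge.\<close>

lemma T_factor_bounds:
  fixes u :: real
  assumes u: "0 < u" "u < 1"
  shows "0 < (1 - u) ^ Suc m + real (Suc m) * u * (1 - u) ^ m"
    and "\<bar>(1 - u) ^ Suc m + real (Suc m) * u * (1 - u) ^ m - 1\<bar> \<le> (real m * u)\<^sup>2"
proof -
  have eq: "(1 - u) ^ Suc m + real (Suc m) * u * (1 - u) ^ m = (1 - u) ^ m * (1 + real m * u)"
    by (simp add: algebra_simps)
  \<comment> \<open>Bernoulli is used twice: \<open>1 + m*u \<le> (1+u)^m\<close> for the upper
    bound, and \<open>1 - m*u \<le> (1-u)^m\<close> for the lower one.\<close>
  have "(1 - u) ^ m * (1 + real m * u) \<le> (1 - u) ^ m * (1 + u) ^ m"
    using u Bernoulli_inequality[of u m] by (intro mult_left_mono) auto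
  also have "\<dots> = (1 - u\<^sup>2) ^ m"
    by (simp add: power2_eq_square algebra_simps flip: power_mult_distrib)
  also have "\<dots> \<le> 1"
    using u by (intro power_le_one) (auto simp: power_le_one)
  finally have upper: "(1 - u) ^ m * (1 + real m * u) \<le> 1" .
  have "(1 - real m * u) * (1 + real m * u) \<le> (1 - u) ^ m * (1 + real m * u)"
    using u Bernoulli_inequality[of "- u" m] by (intro mult_right_mono) auto
  then have lower: "1 - (real m * u)\<^sup>2 \<le> (1 - u) ^ m * (1 + real m * u)"
    by (simp add: power2_eq_square algebra_simps)
  show "0 < (1 - u) ^ Suc m + real (Suc m) * u * (1 - u) ^ m"
    unfolding eq using u by (intro mult_pos_pos add_pos_nonneg) auto
  show "\<bar>(1 - u) ^ Suc m + real (Suc m) * u * (1 - u) ^ m - 1\<bar> \<le> (real m * u)\<^sup>2"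
    unfolding eq using upper lower zero_le_power2[of "real m * u"] by linarith
qed

text \<open>The value of \<open>prodinf\<close> is the limit of the partial products once
  convergence is known. It follows from summable deviations from 1 together with nonvanishing
  factors.\<close>

lemma T_partial_products_tendsto:
  assumes "r \<ge> 1"
  shows "(\<lambda>N. \<Prod>p | prime p \<and> p < N.
            (1 - 1 / real p) ^ r + real r / real p * (1 - 1 / real p) ^ (r - 1)) \<longlonglongrightarrow> T r"
proof -
  let ?g = "\<lambda>p. (1 - 1 / real p) ^ r + real r / real p * (1 - 1 / real p) ^ (r - 1)"
  let ?f = "\<lambda>p. if prime p then ?g p else 1"
  obtain m where m: "r = Suc m" using assms by (cases r) auto
  have g: "?g p > 0" "\<bar>?g p - 1\<bar> \<le> (real m * (1 / real p))\<^sup>2" if "prime p" for p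
    using T_factor_bounds[of "1 / real p" m] prime_gt_1_nat[OF that] by (simp_all add: m)
  have "summable (\<lambda>p. \<bar>?f p - 1\<bar>)"
  proof (rule summable_comparison_test')
    show "summable (\<lambda>p. real m ^ 2 * inverse (real p ^ 2))"
      by (intro summable_mult inverse_power_summable) simp
    fix p :: nat assume "p \<ge> 0"
    show "norm \<bar>?f p - 1\<bar> \<le> real m ^ 2 * inverse (real p ^ 2)"
      using g(2)[of p] by (simp add: power_mult_distrib power_divide inverse_eq_divide)
  qed
  moreover have "?f p - 1 \<noteq> - 1" for p
    using g(1)[of p] by auto
  ultimately have "convergent_prod (\<lambda>p. 1 + (?f p - 1))"
    by (rule summable_imp_convergent_prod_real)
  then have "(\<lambda>n. \<Prod>p\<le>n. ?f p) \<longlonglongrightarrow> T r"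
    unfolding T_def using convergent_prod_LIMSEQ by force
  then have "(\<lambda>N. \<Prod>p<N. ?f p) \<longlonglongrightarrow> T r"
    by (simp only: LIMSEQ_lessThan_iff_atMost)
  moreover have "(\<Prod>p<N. ?f p) = (\<Prod>p | prime p \<and> p < N. ?g p)" for N
    by (subst prod.inter_filter[symmetric]) (auto intro: prod.cong)
  ultimately show ?thesis by simp
qed

text \<open>As soon as \<open>N\<close> exceeds \<open>A\<close>, all prime factors of
  \<open>A\<close> lie below \<open>N\<close>, so the correction has become a constant finite
  product.\<close>

lemma prime_products_modified_tendsto:
  fixes g :: "nat \<Rightarrow> real"
  assumes lim: "(\<lambda>N. \<Prod>p | prime p \<and> p < N. g p) \<longlonglongrightarrow> L" and A: "A > 0"
    and D: "\<And>p. prime p \<Longrightarrow> D p = g p * (if p dvd A then c p else 1)"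
  shows "(\<lambda>N. \<Prod>p | prime p \<and> p < N. D p) \<longlonglongrightarrow> L * (\<Prod>p\<in>prime_factors A. c p)"
proof -
  have "(\<lambda>N. (\<Prod>p | prime p \<and> p < N. g p) * (\<Prod>p\<in>prime_factors A. c p))
          \<longlonglongrightarrow> L * (\<Prod>p\<in>prime_factors A. c p)"
    by (intro tendsto_mult lim tendsto_const)
  moreover have "\<forall>\<^sub>F N in sequentially. (\<Prod>p | prime p \<and> p < N. g p) * (\<Prod>p\<in>prime_factors A. c p) =
      (\<Prod>p | prime p \<and> p < N. D p)"
  proof (rule eventually_sequentiallyI[of "Suc A"])
    fix N assume N: "Suc A \<le> N"
    have "p < N" if "p dvd A" for p
      using dvd_imp_le[OF that A] N by simp
    then have pf: "prime_factors A = {p \<in> {p. prime p \<and> p < N}. p dvd A}"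
      using A by (auto simp: prime_factors_dvd)
    have "(\<Prod>p | prime p \<and> p < N. D p) = (\<Prod>p | prime p \<and> p < N. g p * (if p dvd A then c p else 1))"
      using D by (intro prod.cong) auto
    also have "\<dots> = (\<Prod>p | prime p \<and> p < N. g p) * (\<Prod>p\<in>prime_factors A. c p)"
      unfolding pf by (subst prod.inter_filter) (simp_all add: prod.distrib)
    finally show "(\<Prod>p | prime p \<and> p < N. g p) * (\<Prod>p\<in>prime_factors A. c p) =
        (\<Prod>p | prime p \<and> p < N. D p)" ..
  qed
  ultimately show ?thesis by (rule Lim_transform_eventually)
qed

section \<open>Coprimality conditions prime by prime\<close>

lemma prime_dvd_tuple_prod_iff:
  "prime p \<Longrightarrow> p dvd tuple_prod r a \<longleftrightarrow> (\<exists>i\<in>{1..r}. p dvd a i)"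
  unfolding tuple_prod_def by (rule prime_dvd_prod_iff) auto

text \<open>Pairwise coprimality of \<open>a\<close> enters here: at a prime dividing the product
  exactly one coordinate is restricted, so the local density depends on \<open>a\<close> only
  through the product.\<close>

lemma card_dvd_pairwise_coprime:
  assumes "\<And>i j. i \<in> {1..r} \<Longrightarrow> j \<in> {1..r} \<Longrightarrow> i \<noteq> j \<Longrightarrow> gcd (a i) (a j) = 1"
    and p: "prime p" "p dvd tuple_prod r a"
  shows "card {i \<in> {1..r}. p dvd a i} = 1"
proof -
  obtain k where k: "k \<in> {1..r}" "p dvd a k"
    using p prime_dvd_tuple_prod_iff by blast
  have "i = k" if "i \<in> {1..r}" "p dvd a i" for i
  proof (rule ccontr)
    assume "i \<noteq> k"
    with that k assms(1) have "p dvd 1" by (metis gcd_greatest)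
    with p show False by simp
  qed
  with k have "{i \<in> {1..r}. p dvd a i} = {k}" by blast
  then show ?thesis by simp
qed

text \<open>A gcd differs from 1 exactly when some prime divides it. Pairwise coprimality leaves the
  empty set and singletons as patterns, and coprimality to \<open>a i\<close> rules out the
  singleton of \<open>i\<close> when \<open>p\<close> divides \<open>a i\<close>.\<close>

lemma PC_iff_div_set:
  assumes x: "x \<in> {1..r} \<rightarrow>\<^sub>E {1..n}"
  shows "x \<in> PC r a \<longleftrightarrow> (\<forall>p. prime p \<longrightarrow>
           div_set {1..r} p x \<in> insert {} ((\<lambda>i. {i}) ` {i \<in> {1..r}. \<not> p dvd a i}))"
    (is "_ \<longleftrightarrow> (\<forall>p. prime p \<longrightarrow> ?D p \<in> ?F p)")
proof
  assume PC: "x \<in> PC r a"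
  show "\<forall>p. prime p \<longrightarrow> ?D p \<in> ?F p"
  proof (intro allI impI)
    fix p :: nat assume p: "prime p"
    show "?D p \<in> ?F p"
    proof (cases "?D p = {}")
      case False
      then obtain i where i: "i \<in> {1..r}" "p dvd x i" by (auto simp: div_set_def)
      have "j = i" if "j \<in> ?D p" for j
      proof (rule ccontr)
        assume "j \<noteq> i"
        then have "gcd (x j) (x i) = 1" using PC that i by (auto simp: PC_def div_set_def)
        moreover have "p dvd gcd (x j) (x i)" using that i by (simp add: div_set_def)
        ultimately show False using p by simp
      qed
      then have "?D p = {i}" using i by (auto simp: div_set_def)
      moreover have "\<not> p dvd a i"
      proof
        assume "p dvd a i"
        then have "p dvd gcd (a i) (x i)" using i by simp
        also have "gcd (a i) (x i) = 1" using PC i by (auto simp: PC_def)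
        finally show False using p by simp
      qed
      ultimately show ?thesis using i by blast
    qed simp
  qed
next
  assume D: "\<forall>p. prime p \<longrightarrow> ?D p \<in> ?F p"
  have "gcd (x i) (x j) = 1" if ij: "i \<in> {1..r}" "j \<in> {1..r}" "i \<noteq> j" for i j
  proof (rule ccontr)
    assume "gcd (x i) (x j) \<noteq> 1"
    then obtain p where p: "prime p" "p dvd gcd (x i) (x j)" using prime_factor_nat by blast
    then have "i \<in> ?D p" "j \<in> ?D p" using ij by (auto simp: div_set_def)
    moreover from D p have "?D p \<in> ?F p" by simp
    ultimately show False using ij(3) by auto
  qed
  moreover have "gcd (a i) (x i) = 1" if i: "i \<in> {1..r}" for i
  proof (rule ccontr)
    assume "gcd (a i) (x i) \<noteq> 1"
    then obtain p where p: "prime p" "p dvd gcd (a i) (x i)" using prime_factor_nat by blast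
    then have "i \<in> ?D p" "p dvd a i" using i by (auto simp: div_set_def)
    moreover from D p have "?D p \<in> ?F p" by simp
    ultimately show False by auto
  qed
  ultimately show "x \<in> PC r a"
    using x by (auto simp: PC_def PiE_iff Suc_le_eq)
qed

text \<open>If \<open>p\<close> divides some \<open>a i\<close>, then \<open>gcd (a i) (x i) = 1\<close> already prevents \<open>p\<close> from
  dividing all coordinates.\<close>

lemma MC_iff_div_set:
  assumes x: "x \<in> {1..r} \<rightarrow>\<^sub>E {1..n}"
  shows "x \<in> MC r a \<longleftrightarrow> (\<forall>p. prime p \<longrightarrow> div_set {1..r} p x \<in>
           (if p dvd tuple_prod r a then Pow {i \<in> {1..r}. \<not> p dvd a i} else Pow {1..r} - {{1..r}}))"
    (is "_ \<longleftrightarrow> (\<forall>p. prime p \<longrightarrow> ?D p \<in> ?F p)")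
proof
  assume MC: "x \<in> MC r a"
  show "\<forall>p. prime p \<longrightarrow> ?D p \<in> ?F p"
  proof (intro allI impI)
    fix p :: nat assume p: "prime p"
    have "\<not> p dvd a i" if "i \<in> ?D p" for i
    proof
      assume "p dvd a i"
      then have "p dvd gcd (a i) (x i)" using that by (simp add: div_set_def)
      also have "gcd (a i) (x i) = 1" using MC that by (auto simp: MC_def div_set_def)
      finally show False using p by simp
    qed
    moreover have "?D p \<noteq> {1..r}"
    proof
      assume "?D p = {1..r}"
      then have "p dvd Gcd (x ` {1..r})" by (auto simp: div_set_def intro!: Gcd_greatest)
      also have "Gcd (x ` {1..r}) = 1" using MC by (simp add: MC_def)
      finally show False using p by simp
    qed
    moreover have "?D p \<subseteq> {1..r}" by (auto simp: div_set_def)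
    ultimately show "?D p \<in> ?F p" by auto
  qed
next
  assume D: "\<forall>p. prime p \<longrightarrow> ?D p \<in> ?F p"
  have "Gcd (x ` {1..r}) = 1"
  proof (rule ccontr)
    assume "Gcd (x ` {1..r}) \<noteq> 1"
    then obtain p where p: "prime p" "p dvd Gcd (x ` {1..r})" using prime_factor_nat by blast
    then have "p dvd x i" if "i \<in> {1..r}" for i
      using that by (meson Gcd_dvd dvd_trans imageI)
    then have "?D p = {1..r}" by (auto simp: div_set_def)
    with D p(1) have "{1..r} \<in> ?F p" by metis
    \<comment> \<open>If \<open>p\<close> divides the product, it divides some \<open>a i\<close>,
      and that index is missing from the set allowed by \<open>?F p\<close>.\<close>
    then show False
      using prime_dvd_tuple_prod_iff[OF p(1)] by (auto split: if_splits)
  qed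
  moreover have "gcd (a i) (x i) = 1" if i: "i \<in> {1..r}" for i
  proof (rule ccontr)
    assume "gcd (a i) (x i) \<noteq> 1"
    then obtain p where p: "prime p" "p dvd gcd (a i) (x i)" using prime_factor_nat by blast
    then have "i \<in> ?D p" "p dvd a i" using i by (auto simp: div_set_def)
    then have "p dvd tuple_prod r a" using i p(1) prime_dvd_tuple_prod_iff by blast
    with D p(1) have "?D p \<in> Pow {i \<in> {1..r}. \<not> p dvd a i}" by metis
    with \<open>i \<in> ?D p\<close> \<open>p dvd a i\<close> show False by blast
  qed
  ultimately show "x \<in> MC r a"
    using x by (auto simp: MC_def PiE_iff Suc_le_eq)
qed

section \<open>The two limits\<close>

text \<open>At primes not dividing the product of \<open>a\<close> the local density is the factor
  of \<open>T\<close>. At the others only \<open>r - 1\<close> coordinates may be divisible by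
  \<open>p\<close>, and \<open>?c p\<close> is the resulting ratio to that factor.\<close>

lemma box_dens_PC_tendsto:
  assumes r: "r \<ge> 2" and a_pos: "\<And>i. i \<in> {1..r} \<Longrightarrow> a i > 0"
    and a_coprime: "\<And>i j. i \<in> {1..r} \<Longrightarrow> j \<in> {1..r} \<Longrightarrow> i \<noteq> j \<Longrightarrow> gcd (a i) (a j) = 1"
  shows "(\<lambda>n. box_dens {1..r} n (\<lambda>x. x \<in> PC r a))
           \<longlonglongrightarrow> T r * (Psi (int r - 2) (tuple_prod r a) / Psi (int r - 1) (tuple_prod r a))"
proof -
  let ?A = "tuple_prod r a"
  let ?J = "\<lambda>p. {i \<in> {1..r}. \<not> p dvd a i}"
  let ?F = "\<lambda>p. insert {} ((\<lambda>i. {i}) ` ?J p)"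
  let ?c = "\<lambda>p. (1 + (real r - 2) / real p) / (1 + (real r - 1) / real p)"
  have A: "?A > 0" using a_pos unfolding tuple_prod_def by (intro prod_pos) auto
  obtain m where m: "r = Suc m" "m \<ge> 1" using r by (cases r) auto
  have "(\<lambda>N. \<Prod>p | prime p \<and> p < N. local_dens {1..r} p (?F p)) \<longlonglongrightarrow> T r * (\<Prod>p\<in>prime_factors ?A. ?c p)"
  proof (rule prime_products_modified_tendsto[OF T_partial_products_tendsto A])
    fix p :: nat assume p: "prime p"
    have p0: "real p > 0" using p by (simp add: prime_gt_0_nat)
    have ld: "local_dens {1..r} p (?F p) =
        (1 - 1 / real p) ^ r + real (card (?J p)) / real p * (1 - 1 / real p) ^ (r - 1)"
      by (subst local_dens_at_most_one) auto
    show "local_dens {1..r} p (?F p) =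
        ((1 - 1 / real p) ^ r + real r / real p * (1 - 1 / real p) ^ (r - 1)) * (if p dvd ?A then ?c p else 1)"
    proof (cases "p dvd ?A")
      case True
      have one: "card {i \<in> {1..r}. p dvd a i} = 1"
        using a_coprime p True by (rule card_dvd_pairwise_coprime)
      have "?J p = {1..r} - {i \<in> {1..r}. p dvd a i}" by auto
      also have "card \<dots> = card {1..r} - card {i \<in> {1..r}. p dvd a i}"
        by (rule card_Diff_subset) auto
      finally have card: "card (?J p) = m"
        by (simp only: one) (simp add: m(1))
      \<comment> \<open>Used with \<open>s = r - 1\<close> for the actual density and with
        \<open>s = r\<close> for the factor of \<open>T\<close>; the common power cancels and leaves
        \<open>?c p\<close>.\<close>
      have factor: "(1 - 1 / real p) ^ r + s / real p * (1 - 1 / real p) ^ (r - 1) =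
          (1 - 1 / real p) ^ m * (1 + (s - 1) / real p)" for s
        by (simp add: m(1) algebra_simps diff_divide_distrib)
      have "1 + (real r - 1) / real p > 0"
        using p0 r by (intro add_pos_nonneg divide_nonneg_pos) auto
      then show ?thesis
        using True unfolding ld card factor by (simp add: m(1))
    next
      case False
      then have "?J p = {1..r}" using prime_dvd_tuple_prod_iff[OF p] by auto
      then show ?thesis using False unfolding ld by simp
    qed
  qed (use r in auto)
  moreover have "(\<Prod>p\<in>prime_factors ?A. ?c p) = Psi (int r - 2) ?A / Psi (int r - 1) ?A"
    using A by (simp add: Psi_def prod_dividef)
  ultimately have lim: "(\<lambda>N. \<Prod>p | prime p \<and> p < N. local_dens {1..r} p (?F p))
      \<longlonglongrightarrow> T r * (Psi (int r - 2) ?A / Psi (int r - 1) ?A)" by simp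
  have "(\<lambda>n. box_dens {1..r} n (\<lambda>x. \<forall>p. prime p \<longrightarrow> div_set {1..r} p x \<in> ?F p))
      \<longlonglongrightarrow> T r * (Psi (int r - 2) ?A / Psi (int r - 1) ?A)"
  proof (rule box_dens_prime_sieve_tendsto[OF _ _ _ lim])
    \<comment> \<open>A prime above \<open>?A\<close> cannot divide it, so \<open>Suc ?A\<close>
      serves as the threshold of the sieve.\<close>
    fix p b assume p: "prime p" "p \<ge> Suc ?A" and b: "b \<subseteq> {1..r}" "b \<notin> ?F p"
    have "\<not> p dvd ?A" using p A by (auto dest: dvd_imp_le)
    then have "?J p = {1..r}" using prime_dvd_tuple_prod_iff[OF p(1)] by auto
    with b have "b \<notin> insert {} ((\<lambda>i. {i}) ` {1..r})" by simp
    with b(1) show "\<exists>i\<in>b. \<exists>j\<in>b. i \<noteq> j" by blast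
  qed auto
  then show ?thesis
    using PC_iff_div_set by (subst box_dens_cong) auto
qed

text \<open>At primes not dividing the product of \<open>a\<close> the local density is the Euler
  factor of \<open>1/zeta(r)\<close>. At the others it is \<open>1 - 1/p\<close>, since just one
  coordinate must avoid \<open>p\<close>; \<open>?c p\<close> is the ratio.\<close>

lemma box_dens_MC_tendsto:
  assumes r: "r \<ge> 2" and a_pos: "\<And>i. i \<in> {1..r} \<Longrightarrow> a i > 0"
    and a_coprime: "\<And>i j. i \<in> {1..r} \<Longrightarrow> j \<in> {1..r} \<Longrightarrow> i \<noteq> j \<Longrightarrow> gcd (a i) (a j) = 1"
  shows "(\<lambda>n. box_dens {1..r} n (\<lambda>x. x \<in> MC r a))
           \<longlonglongrightarrow> 1 / riemann_zeta (real r)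
               * (real (totient (tuple_prod r a)) / jordan_totient r (tuple_prod r a))
               * real (tuple_prod r a) ^ (r - 1)" (is "_ \<longlonglongrightarrow> ?L")
proof -
  let ?A = "tuple_prod r a"
  let ?J = "\<lambda>p. {i \<in> {1..r}. \<not> p dvd a i}"
  let ?F = "\<lambda>p. if p dvd ?A then Pow (?J p) else Pow {1..r} - {{1..r}}"
  let ?c = "\<lambda>p. (1 - 1 / real p) / (1 - 1 / real p ^ r)"
  have A: "?A > 0" using a_pos unfolding tuple_prod_def by (intro prod_pos) auto
  have "(\<lambda>N. \<Prod>p | prime p \<and> p < N. local_dens {1..r} p (?F p))
          \<longlonglongrightarrow> 1 / riemann_zeta (real r) * (\<Prod>p\<in>prime_factors ?A. ?c p)"
  proof (rule prime_products_modified_tendsto[OF euler_product_tendsto[OF r] A])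
    fix p :: nat assume p: "prime p"
    show "local_dens {1..r} p (?F p) = (1 - 1 / real p ^ r) * (if p dvd ?A then ?c p else 1)"
    proof (cases "p dvd ?A")
      case True
      have "{1..r} - ?J p = {i \<in> {1..r}. p dvd a i}" by auto
      then have card: "card ({1..r} - ?J p) = 1"
        using card_dvd_pairwise_coprime[OF a_coprime p True] by simp
      have "real p ^ r > 1" using prime_gt_1_nat[OF p] r by (intro one_less_power) auto
      then have "1 - 1 / real p ^ r \<noteq> 0" by simp
      moreover have "local_dens {1..r} p (Pow (?J p)) = 1 - 1 / real p"
        by (subst local_dens_Pow) (use card in auto)
      ultimately show ?thesis using True by simp
    next
      case False
      then show ?thesis by (simp add: local_dens_Pow_minus_whole)
    qed
  qed
  moreover have "1 / riemann_zeta (real r) * (\<Prod>p\<in>prime_factors ?A. ?c p) = ?L"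
  proof -
    \<comment> \<open>The powers of \<open>?A\<close> in the totient, the Jordan totient and the
      last factor of the limit cancel.\<close>
    have "real ?A ^ r = real ?A * real ?A ^ (r - 1)"
      using r by (cases r) simp_all
    then show ?thesis
      using A by (simp add: totient_formula2 jordan_totient_def prod_dividef)
  qed
  ultimately have lim: "(\<lambda>N. \<Prod>p | prime p \<and> p < N. local_dens {1..r} p (?F p)) \<longlonglongrightarrow> ?L"
    by simp
  have "(\<lambda>n. box_dens {1..r} n (\<lambda>x. \<forall>p. prime p \<longrightarrow> div_set {1..r} p x \<in> ?F p)) \<longlonglongrightarrow> ?L"
  proof (rule box_dens_prime_sieve_tendsto[OF _ _ _ lim])
    fix p b assume p: "prime p" "p \<ge> Suc ?A" and b: "b \<subseteq> {1..r}" "b \<notin> ?F p"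
    have "\<not> p dvd ?A" using p A by (auto dest: dvd_imp_le)
    with b have "b = {1..r}" by auto
    \<comment> \<open>The excluded pattern is the full index set, which has two distinct elements
      because \<open>r \<ge> 2\<close>.\<close>
    then show "\<exists>i\<in>b. \<exists>j\<in>b. i \<noteq> j"
      using r by (intro bexI[of _ 1] bexI[of _ 2]) auto
  qed auto
  then show ?thesis
    using MC_iff_div_set by (subst box_dens_cong) auto
qed

theorem theorem3p1:
  fixes r :: nat and a :: "nat \<Rightarrow> nat"
    and M :: "nat \<Rightarrow> 'w measure" and X :: "nat \<Rightarrow> nat \<Rightarrow> 'w \<Rightarrow> nat"
  assumes r: "r \<ge> 2"
    and a_pos: "\<And>i. i \<in> {1..r} \<Longrightarrow> a i > 0"
    and a_coprime: "\<And>i j. i \<in> {1..r} \<Longrightarrow> j \<in> {1..r} \<Longrightarrow> i \<noteq> j \<Longrightarrow> gcd (a i) (a j) = 1"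
    and prob: "\<And>n. n \<ge> 2 \<Longrightarrow> prob_space (M n)"
    and indep: "\<And>n. n \<ge> 2 \<Longrightarrow>
          prob_space.indep_vars (M n) (\<lambda>_. count_space UNIV) (X n) {1..r}"
    and uniform: "\<And>n j. n \<ge> 2 \<Longrightarrow> j \<in> {1..r} \<Longrightarrow>
          distr (M n) (count_space UNIV) (X n j) = measure_pmf (pmf_of_set {1..n})"
  shows "((\<lambda>n. \<P>(\<omega> in M n. (\<lambda>j\<in>{1..r}. X n j \<omega>) \<in> PC r a))
            \<longlonglongrightarrow> T r * (Psi (int r - 2) (tuple_prod r a) / Psi (int r - 1) (tuple_prod r a)))
       \<and> ((\<lambda>n. \<P>(\<omega> in M n. (\<lambda>j\<in>{1..r}. X n j \<omega>) \<in> MC r a))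
            \<longlonglongrightarrow> 1 / riemann_zeta (real r)
               * (real (totient (tuple_prod r a)) / jordan_totient r (tuple_prod r a))
               * real (tuple_prod r a) ^ (r - 1))"
proof -
  have eq: "\<P>(\<omega> in M n. (\<lambda>j\<in>{1..r}. X n j \<omega>) \<in> S) = box_dens {1..r} n (\<lambda>x. x \<in> S)"
    if "n \<ge> 2" for n S
    using that r by (intro prob_space.prob_uniform_tuple prob indep uniform) auto
  \<comment> \<open>\<open>M n\<close> is known to be a probability space only from
    \<open>n = 2\<close> on, so the probabilities agree with the box densities eventually, which
    suffices for the limits.\<close>
  have ev: "\<forall>\<^sub>F n in sequentially.
      box_dens {1..r} n (\<lambda>x. x \<in> S) = \<P>(\<omega> in M n. (\<lambda>j\<in>{1..r}. X n j \<omega>) \<in> S)" for S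
    using eq by (intro eventually_sequentiallyI[of 2]) simp
  show ?thesis
    by (intro conjI Lim_transform_eventually[OF _ ev] box_dens_PC_tendsto box_dens_MC_tendsto
        r a_pos a_coprime)
qed

end
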